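(* Let $n$ be a positive integer. Then $\varphi_{12}(n)$ is odd if and only if $n=2^{\alpha}$ with $\alpha\ge4$, or $n=3\cdot 2^{\alpha}$ with $\alpha\ge2$, or $n=2\cdot 3^{\beta}$ with $\beta\ge2$, or $n=4\cdot3^{\beta}$ with $\beta\ge 2$, or $n$ is of one of the following forms, where $p>3$ is a prime and $\alpha\ge1$ an integer: (1) $n=p^{\alpha}$ with $p\equiv 13,17,19$ or $23\pmod{24}$; (2) $n=2p^{\alpha}$ with $p\equiv 7,11,13$ or $17\pmod{24}$; (3) $n=3p^{\alpha}$ with $p\equiv 5$ or $7\pmod{12}$; (4) $n=4p^{\alpha}$ with $p\equiv 5$ or $7\pmod{12}$; (5) $n=6p^{\alpha}$ with $p\equiv 5$ or $7\pmod{12}$; (6) $n=12p^{\alpha}$ with $p\equiv 5$ or $11\pmod{12}$.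
   Context: For positive integers $n,e$, the generalized Euler function is $\varphi_e(n)=\#\{i\in\mathbb{Z}: 1\le i\le \lfloor n/e\rfloor,\ \gcd(i,n)=1\}$, where $\lfloor x\rfloor$ is the greatest integer not exceeding $x$. *)

theory Defs
  imports "HOL-Number_Theory.Number_Theory"
begin

(* For n, e >= 1 the natural-number quotient n div e is the floor of n/e. *)
definition gen_totient :: "nat \<Rightarrow> nat \<Rightarrow> nat" where
  "gen_totient e n = card {i. 1 \<le> i \<and> i \<le> n div e \<and> gcd i n = 1}"

end

theory Submission
  imports Defs
begin

text \<open>Removing a prime \<^term>\<open>p\<close> from the modulus \<^term>\<open>n\<close> splits a count of integers coprime to
  \<^term>\<open>n\<close> into two counts, one of them over an interval shortened by the factor \<^term>\<open>p\<close>. Iterating, the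
  parity of $\varphi_{12}(n)$ becomes a sum of terms \<^term>\<open>F (n div d)\<close> over the squarefree divisors
  \<^term>\<open>d\<close> of \<^term>\<open>n\<close>, where \<^term>\<open>F x\<close>, the parity of \<^term>\<open>x div 12\<close>, depends on \<^term>\<open>x mod 24\<close> only.
  Since the units modulo 24 form an elementary abelian 2-group, the contribution of a prime
  \<^term>\<open>p > 3\<close> does not depend on its exponent and amounts to replacing \<^term>\<open>F x\<close> by
  \<^term>\<open>F x + F (p * x)\<close>; doing this for two primes annihilates \<^term>\<open>F\<close> modulo 2. So an odd count
  forces the part of \<^term>\<open>n\<close> coprime to 6 to be a prime power or 1, and a finite table remains.\<close>

section \<open>Removing one prime from the modulus of a coprimality count\<close>

definition coprime_count :: "nat \<Rightarrow> nat \<Rightarrow> nat" where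
  "coprime_count x m = card {i \<in> {1..x}. coprime i m}"

text \<open>Split by divisibility by \<open>p\<close>: non-multiples of \<open>p\<close> give the
  first count, and a multiple \<open>p * j\<close> is coprime to \<open>m\<close> exactly when
  \<open>j\<close> is, because \<open>p\<close> does not divide \<open>m\<close>.\<close>

lemma coprime_count_prime_power:
  assumes "prime p" "\<not> p dvd m" "a > 0"
  shows "coprime_count x m = coprime_count x (p ^ a * m) + coprime_count (x div p) m"
proof -
  have p0: "p > 0" using assms(1) by (simp add: prime_gt_0_nat)
  have cop: "coprime i (p ^ a * m) \<longleftrightarrow> \<not> p dvd i \<and> coprime i m" for i
  proof -
    have "coprime i p \<longleftrightarrow> \<not> p dvd i"
      using assms(1) by (metis coprime_commute coprime_absorb_left not_prime_unit prime_imp_coprime)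
    then show ?thesis using assms(3) by simp
  qed
  have pm: "coprime p m" using assms by (simp add: prime_imp_coprime)
  have "{i \<in> {1..x}. coprime i m} =
      {i \<in> {1..x}. coprime i (p ^ a * m)} \<union> (*) p ` {j \<in> {1..x div p}. coprime j m}"
    (is "?A = ?B \<union> ?C")
  proof (rule Set.set_eqI, rule iffI)
    fix i assume i: "i \<in> ?A"
    show "i \<in> ?B \<union> ?C"
    proof (cases "p dvd i")
      case True
      then obtain j where j: "i = p * j" by blast
      have "j \<in> {j \<in> {1..x div p}. coprime j m}"
        using i p0 unfolding j by (auto simp: less_eq_div_iff_mult_less_eq mult.commute)
      then show ?thesis using j by blast
    next
      case False
      then show ?thesis using i cop by auto
    qed
  next
    fix i assume "i \<in> ?B \<union> ?C"
    then show "i \<in> ?A"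
    proof
      assume "i \<in> ?C"
      then obtain j where "i = p * j" "j \<ge> 1" "j \<le> x div p" "coprime j m" by auto
      then show ?thesis
        using p0 pm by (simp add: less_eq_div_iff_mult_less_eq mult.commute)
    qed (simp add: cop)
  qed
  moreover have "?B \<inter> ?C = {}" using cop dvd_triv_left by blast
  moreover have "card ?C = coprime_count (x div p) m"
    using p0 unfolding coprime_count_def by (intro card_image) (auto simp: inj_on_def)
  ultimately show ?thesis
    unfolding coprime_count_def by (simp add: card_Un_disjoint)
qed

text \<open>The cofactor \<^term>\<open>y\<close> records the part of \<^term>\<open>n\<close> already removed from the modulus.\<close>

definition odd_count :: "nat \<Rightarrow> nat \<Rightarrow> nat \<Rightarrow> bool" where
  "odd_count e y m = odd (coprime_count (y * m div e) m)"

lemma odd_gen_totient_iff: "odd (gen_totient e n) \<longleftrightarrow> odd_count e 1 n"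
proof -
  have "{i. 1 \<le> i \<and> i \<le> n div e \<and> gcd i n = 1} = {i \<in> {1..n div e}. coprime i n}"
    unfolding coprime_iff_gcd_eq_1 by auto
  then show ?thesis
    by (simp add: gen_totient_def odd_count_def coprime_count_def)
qed

lemma odd_count_one: "odd_count e y 1 \<longleftrightarrow> odd (y div e)"
proof -
  have "{i \<in> {1..x}. coprime i 1} = {1..x}" for x :: nat by auto
  then show ?thesis by (simp only: odd_count_def coprime_count_def card_atLeastAtMost) simp
qed

text \<open>Modulo 2 the sum of counts becomes the exclusive or \<open>\<noteq>\<close>. The guard
  \<open>a > 0\<close> matters: for \<open>a = 0\<close> the truncated exponent \<open>a - 1\<close>
  would repeat the first term and cancel it.\<close>

lemma odd_count_prime_power:
  assumes "prime p" "\<not> p dvd m"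
  shows "odd_count e y (p ^ a * m) \<longleftrightarrow>
    (odd_count e (p ^ a * y) m \<noteq> (a > 0 \<and> odd_count e (p ^ (a - 1) * y) m))"
proof (cases "a > 0")
  case True
  have p0: "p > 0" using assms(1) by (simp add: prime_gt_0_nat)
  \<comment> \<open>Floor divisions by \<open>e\<close> and \<open>p\<close> commute, so dividing
    the bound by \<open>p\<close> only lowers the exponent in the cofactor.\<close>
  have "y * (p ^ a * m) div e div p = y * (p ^ a * m) div p div e"
    by (metis div_mult2_eq mult.commute)
  also have "y * (p ^ a * m) div p = p ^ (a - 1) * y * m"
  proof -
    have "y * (p ^ a * m) = p * (p ^ (a - 1) * y * m)"
      using True by (cases a) simp_all
    then show ?thesis using p0 by (metis nonzero_mult_div_cancel_left gr_implies_not0)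
  qed
  finally have "y * (p ^ a * m) div e div p = p ^ (a - 1) * y * m div e" .
  then show ?thesis
    using coprime_count_prime_power[OF assms True, of "y * (p ^ a * m) div e"] True
    by (auto simp: odd_count_def ac_simps)
qed simp

section \<open>Prime powers coprime to 6, modulo 24\<close>

definition odd_quot12 :: "nat \<Rightarrow> bool" where
  "odd_quot12 x \<longleftrightarrow> 12 \<le> x mod 24"

lemma odd_count_12_one: "odd_count 12 y 1 \<longleftrightarrow> odd_quot12 y"
  using mod_mult2_eq[of y 12 2]
  by (auto simp: odd_count_one[unfolded One_nat_def] odd_quot12_def odd_iff_mod_2_eq_one even_iff_mod_2_eq_zero)

lemma odd_quot12_cong: "x mod 24 = y mod 24 \<Longrightarrow> odd_quot12 x = odd_quot12 y"
  by (simp add: odd_quot12_def)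

lemma prime_mod_24:
  fixes p :: nat
  assumes "prime p" "p > 3"
  shows "p mod 24 \<in> set [1, 5, 7, 11, 13, 17, 19, 23]"
proof -
  have "\<not> 2 dvd p" "\<not> 3 dvd p"
    using assms by (auto dest: primes_dvd_imp_eq[rotated 2])
  then have "\<not> 2 dvd p mod 24" "\<not> 3 dvd p mod 24"
    by (simp_all add: dvd_mod_iff)
  moreover have "p mod 24 \<in> set [0..<24]" by simp
  moreover have "\<forall>r\<in>set [0..<24]. \<not> 2 dvd r \<longrightarrow> \<not> 3 dvd r \<longrightarrow>
      r \<in> set [1, 5, 7, 11, 13, 17, 19, 23::nat]"
    by code_simp
  ultimately show ?thesis by blast
qed

lemma prime_power_mod_24:
  fixes p :: nat
  assumes "prime p" "p > 3"
  shows "p ^ a mod 24 = (if even a then 1 else p mod 24)"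
proof -
  have "p ^ 2 mod 24 = (p mod 24) ^ 2 mod 24"
    by (simp add: power_mod)
  also have "\<dots> = 1"
    using prime_mod_24[OF assms] by auto
  finally have sq: "p ^ 2 mod 24 = 1" .
  have "p ^ (2 * k) mod 24 = 1" for k
    using power_mod[of "p ^ 2" 24 k] sq by (simp add: power_mult)
  then show ?thesis
    by (auto elim!: evenE oddE simp flip: mod_mult_right_eq)
qed

text \<open>Exactly one of \<open>a\<close> and \<open>a - 1\<close> is even, so modulo 24 the
  cofactors are \<open>y\<close> and \<open>p * y\<close> in some order, and exclusive or is
  symmetric.\<close>

lemma odd_count_12_prime_power:
  assumes "prime p" "p > 3" "a > 0"
  shows "odd_count 12 y (p ^ a) \<longleftrightarrow> (odd_quot12 y \<noteq> odd_quot12 (p * y))"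
proof -
  have red: "odd_quot12 (p ^ k * y) = (if even k then odd_quot12 y else odd_quot12 (p * y))" for k
    using prime_power_mod_24[OF assms(1,2), of k]
    by (auto intro!: odd_quot12_cong intro: mod_mult_cong simp flip: mod_mult_left_eq[of "p ^ k"])
  have "\<not> p dvd 1" using assms(1) not_prime_unit by blast
  from odd_count_prime_power[OF assms(1) this, of 12 y a] assms(3) show ?thesis
    unfolding mult_1_right odd_count_12_one red by (auto simp: odd_quot12_def)
qed

text \<open>Equivalently, an even number of \<open>x\<close>, \<open>p * x\<close>,
  \<open>q * x\<close>, \<open>q * (p * x)\<close> satisfy \<open>odd_quot12\<close>. Only residues
  modulo 24 matter, so a finite check suffices.\<close>

lemma odd_quot12_two_units:
  assumes "p mod 24 \<in> set [1, 5, 7, 11, 13, 17, 19, 23]"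
    and "q mod 24 \<in> set [1, 5, 7, 11, 13, 17, 19, 23]"
  shows "(odd_quot12 x \<noteq> odd_quot12 (q * x)) = (odd_quot12 (p * x) \<noteq> odd_quot12 (q * (p * x)))"
proof -
  have "\<forall>x\<in>{..<24}. \<forall>p\<in>set [1, 5, 7, 11, 13, 17, 19, 23::nat].
      \<forall>q\<in>set [1, 5, 7, 11, 13, 17, 19, 23].
      ((12 \<le> x) \<noteq> (12 \<le> q * x mod 24)) = ((12 \<le> p * x mod 24) \<noteq> (12 \<le> q * (p * x) mod 24))"
    by (simp add: lessThan_nat_numeral)
  moreover have "x mod 24 \<in> {..<24}" by simp
  ultimately have "((12 \<le> x mod 24) \<noteq> (12 \<le> (q mod 24) * (x mod 24) mod 24)) =
      ((12 \<le> (p mod 24) * (x mod 24) mod 24) \<noteq>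
        (12 \<le> (q mod 24) * ((p mod 24) * (x mod 24)) mod 24))"
    using assms by blast
  moreover have "q mod 24 * (p mod 24 * (x mod 24)) mod 24 = q * (p * x) mod 24"
    by (metis mod_mult_eq mod_mult_right_eq)
  ultimately show ?thesis
    unfolding odd_quot12_def by (simp only: mod_mult_eq)
qed

text \<open>Split off one prime power: the two resulting terms agree and cancel. The induction needs
  \<open>y\<close> arbitrary because they have different cofactors.\<close>

lemma not_odd_count_12_of_not_prime_power:
  assumes "\<not> 2 dvd k" "\<not> 3 dvd k" "k > 1" "\<nexists>p a. prime p \<and> a > 0 \<and> k = p ^ a"
  shows "\<not> odd_count 12 y k"
  using assms
proof (induction k arbitrary: y rule: less_induct)
  case (less k)
  obtain p where p: "prime p" "p dvd k"
    using less.prems(3) prime_factor_nat by (metis nat_neq_iff)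
  define a where "a = multiplicity p k"
  obtain k' where k: "k = p ^ a * k'" and nd: "\<not> p dvd k'"
    using multiplicity_decompose'[of k p] less.prems(3) p(1) not_prime_unit
    unfolding a_def by (metis not_one_less_zero)
  have a: "a > 0"
    using p nd k by (cases a) auto
  have p3: "p > 3"
    using p less.prems(1,2) prime_gt_1_nat[OF p(1)] by (metis Suc_leI Suc_1 eval_nat_numeral(3) le_neq_implies_less)
  have k'1: "k' > 1"
    using less.prems(3,4) k p(1) a by (metis less_one linorder_neqE_nat mult_0_right mult_1_right not_less_zero)
  have k'k: "k' < k"
    using k k'1 one_less_power[OF prime_gt_1_nat[OF p(1)] a] by simp
  have nd': "\<not> 2 dvd k'" "\<not> 3 dvd k'"
    using less.prems(1,2) k by auto
  have "odd_count 12 (p ^ a * y) k' = odd_count 12 (p ^ (a - 1) * y) k'"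
  proof (cases "\<exists>q b. prime q \<and> b > 0 \<and> k' = q ^ b")
    case True
    then obtain q b where q: "prime q" "b > 0" "k' = q ^ b" by blast
    have "q dvd k'" using q by simp
    then have q3: "q > 3"
      using q nd' prime_gt_1_nat[OF q(1)] by (metis Suc_leI Suc_1 eval_nat_numeral(3) le_neq_implies_less)
    \<comment> \<open>The cofactors differ by the factor \<open>p\<close>, so the two-unit identity
      applies with \<open>x = p ^ (a - 1) * y\<close>.\<close>
    have "p ^ a * y = p * (p ^ (a - 1) * y)"
      using a by (cases a) auto
    with odd_quot12_two_units[OF prime_mod_24[OF p(1) p3] prime_mod_24[OF q(1) q3]] show ?thesis
      unfolding q(3) odd_count_12_prime_power[OF q(1) q3 q(2)] by metis
  next
    case False
    then show ?thesis using less.IH[OF k'k nd' k'1] by blast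
  qed
  then show ?case
    using odd_count_prime_power[OF p(1) nd, of 12 y a] k a by simp
qed

section \<open>The primes 2 and 3\<close>

lemma two_power_mod_24: "a \<ge> 3 \<Longrightarrow> 2 ^ a mod 24 = (if even a then 16 else 8 :: nat)"
  by (induction a rule: dec_induct) (auto simp: mod_mult_right_eq[of 2 "2 ^ _" 24, symmetric])

lemma three_power_mod_24: "b \<ge> 1 \<Longrightarrow> 3 ^ b mod 24 = (if even b then 9 else 3 :: nat)"
  by (induction b rule: dec_induct) (auto simp: mod_mult_right_eq[of 3 "3 ^ _" 24, symmetric])

text \<open>The combined contribution of the primes 2 and 3; it depends on \<^term>\<open>min a 4\<close> and
  \<^term>\<open>min b 2\<close> only, since the powers of 2 and of 3 modulo 24 alternate from then on.\<close>

definition strip23 :: "nat \<Rightarrow> nat \<Rightarrow> (nat \<Rightarrow> bool) \<Rightarrow> bool" where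
  "strip23 a b h \<longleftrightarrow>
    ((h (2 ^ a * 3 ^ b) \<noteq> (b > 0 \<and> h (2 ^ a * 3 ^ (b - 1)))) \<noteq>
     (a > 0 \<and> (h (2 ^ (a - 1) * 3 ^ b) \<noteq> (b > 0 \<and> h (2 ^ (a - 1) * 3 ^ (b - 1))))))"

lemma odd_gen_totient_smooth_mult:
  assumes "\<not> 2 dvd k" "\<not> 3 dvd k"
  shows "odd (gen_totient e (2 ^ a * 3 ^ b * k)) \<longleftrightarrow> strip23 a b (\<lambda>y. odd_count e y k)"
proof -
  have "\<not> 2 dvd 3 ^ b * k" using assms by simp
  from odd_count_prime_power[OF two_is_prime_nat this, of e 1 a]
  have two: "odd_count e 1 (2 ^ a * 3 ^ b * k) \<longleftrightarrow> (odd_count e (2 ^ a) (3 ^ b * k) \<noteq>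
      (a > 0 \<and> odd_count e (2 ^ (a - 1)) (3 ^ b * k)))"
    unfolding mult.assoc mult_1_right .
  have "prime (3::nat)" by simp
  note three = odd_count_prime_power[OF this assms(2), of e _ b]
  show ?thesis
    unfolding odd_gen_totient_iff strip23_def two three
    by (simp only: mult.commute[of "3 ^ _"])
qed

text \<open>The thresholds 4 and 2 keep the lowered exponents \<open>a - 1\<close> and
  \<open>b - 1\<close> in the alternating ranges. A change of parity of \<open>a\<close> or
  \<open>b\<close> only swaps terms of a symmetric sum.\<close>

lemma strip23_min:
  assumes per: "\<And>x y. x mod 24 = y mod 24 \<Longrightarrow> h x = h y"
  shows "strip23 a b h = strip23 (min a 4) (min b 2) h"
proof -
  have A: "strip23 a b h = strip23 4 b h" if "a \<ge> 4"
  proof -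
    have r: "h (2 ^ c * z) = h ((if even c then 16 else 8) * z)" if "c \<ge> 3" for c z
      using two_power_mod_24[OF that] by (intro per mod_mult_cong) auto
    show ?thesis
      unfolding strip23_def using that by (auto simp: r)
  qed
  have B: "strip23 a b h = strip23 a 2 h" if "b \<ge> 2" for a
  proof -
    have r: "h (z * 3 ^ c) = h (z * (if even c then 9 else 3))" if "c \<ge> 1" for c z
      using three_power_mod_24[OF that] by (intro per mod_mult_cong) auto
    show ?thesis
      unfolding strip23_def using that by (auto simp: r)
  qed
  show ?thesis
    using A B by (cases "a \<ge> 4"; cases "b \<ge> 2") (auto simp: min_def)
qed

lemma min_4_cases: "min a 4 \<in> {0, 1, 2, 3, 4 :: nat}" and min_2_cases: "min a 2 \<in> {0, 1, 2 :: nat}"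
  by auto

lemma odd_gen_totient_12_smooth:
  "odd (gen_totient 12 (2 ^ a * 3 ^ b)) \<longleftrightarrow>
    b = 0 \<and> a \<ge> 4 \<or> b = 1 \<and> a \<ge> 2 \<or> b \<ge> 2 \<and> (a = 1 \<or> a = 2)"
proof -
  have "odd (gen_totient 12 (2 ^ a * 3 ^ b)) = strip23 a b odd_quot12"
    using odd_gen_totient_smooth_mult[of 1 12 a b] by (simp add: odd_count_12_one[unfolded One_nat_def])
  also have "\<dots> = strip23 (min a 4) (min b 2) odd_quot12"
    by (intro strip23_min odd_quot12_cong)
  also have "\<dots> \<longleftrightarrow> min b 2 = 0 \<and> min a 4 = 4 \<or> min b 2 = 1 \<and> min a 4 \<ge> 2 \<or>
      min b 2 = 2 \<and> (min a 4 = 1 \<or> min a 4 = 2)"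
    using min_4_cases[of a] min_2_cases[of b]
    by (elim insertE emptyE) (simp_all add: strip23_def odd_quot12_def)
  also have "\<dots> \<longleftrightarrow> b = 0 \<and> a \<ge> 4 \<or> b = 1 \<and> a \<ge> 2 \<or> b \<ge> 2 \<and> (a = 1 \<or> a = 2)"
    by (auto simp: min_def)
  finally show ?thesis .
qed

lemma odd_gen_totient_12_prime_power:
  assumes "prime p" "p > 3" "\<alpha> > 0"
  shows "odd (gen_totient 12 (2 ^ a * 3 ^ b * p ^ \<alpha>)) \<longleftrightarrow>
    a = 0 \<and> b = 0 \<and> p mod 24 \<in> {13, 17, 19, 23} \<or>
    a = 1 \<and> b = 0 \<and> p mod 24 \<in> {7, 11, 13, 17} \<or>
    a = 0 \<and> b = 1 \<and> p mod 12 \<in> {5, 7} \<or>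
    a = 2 \<and> b = 0 \<and> p mod 12 \<in> {5, 7} \<or>
    a = 1 \<and> b = 1 \<and> p mod 12 \<in> {5, 7} \<or>
    a = 2 \<and> b = 1 \<and> p mod 12 \<in> {5, 11}"
proof -
  \<comment> \<open>Reducing \<open>p\<close> modulo 24 leaves finitely many functions
    \<open>?h\<close>, none involving \<alpha>, so a table over truncated exponents and residues
    decides everything.\<close>
  let ?h = "\<lambda>y. odd_quot12 y \<noteq> odd_quot12 (p mod 24 * y)"
  have pm: "odd_quot12 (p * y) = odd_quot12 (p mod 24 * y)" for y
    by (intro odd_quot12_cong) (simp add: mod_simps)
  have "\<not> 2 dvd p" "\<not> 3 dvd p"
    using assms by (auto dest: primes_dvd_imp_eq[rotated 2])
  then have "\<not> 2 dvd p ^ \<alpha>" "\<not> 3 dvd p ^ \<alpha>"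
    by (auto dest: prime_dvd_power_nat[rotated])
  then have "odd (gen_totient 12 (2 ^ a * 3 ^ b * p ^ \<alpha>)) = strip23 a b ?h"
    by (simp only: odd_gen_totient_smooth_mult odd_count_12_prime_power[OF assms] pm not_False_eq_True)
  also have "\<dots> = strip23 (min a 4) (min b 2) ?h"
    by (intro strip23_min arg_cong2[of _ _ _ _ "(\<noteq>)"] odd_quot12_cong mod_mult_cong) auto
  also have "\<dots> \<longleftrightarrow>
    min a 4 = 0 \<and> min b 2 = 0 \<and> p mod 24 \<in> {13, 17, 19, 23} \<or>
    min a 4 = 1 \<and> min b 2 = 0 \<and> p mod 24 \<in> {7, 11, 13, 17} \<or>
    min a 4 = 0 \<and> min b 2 = 1 \<and> p mod 24 mod 12 \<in> {5, 7} \<or>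
    min a 4 = 2 \<and> min b 2 = 0 \<and> p mod 24 mod 12 \<in> {5, 7} \<or>
    min a 4 = 1 \<and> min b 2 = 1 \<and> p mod 24 mod 12 \<in> {5, 7} \<or>
    min a 4 = 2 \<and> min b 2 = 1 \<and> p mod 24 mod 12 \<in> {5, 11}"
  proof -
    have "\<forall>a\<in>{..<5}. \<forall>b\<in>{..<3}. \<forall>r\<in>set [1, 5, 7, 11, 13, 17, 19, 23].
      strip23 a b (\<lambda>y. odd_quot12 y \<noteq> odd_quot12 (r * y)) \<longleftrightarrow>
        a = 0 \<and> b = 0 \<and> r \<in> {13, 17, 19, 23} \<or> a = 1 \<and> b = 0 \<and> r \<in> {7, 11, 13, 17} \<or>
        a = 0 \<and> b = 1 \<and> r mod 12 \<in> {5, 7} \<or> a = 2 \<and> b = 0 \<and> r mod 12 \<in> {5, 7} \<or>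
        a = 1 \<and> b = 1 \<and> r mod 12 \<in> {5, 7} \<or> a = 2 \<and> b = 1 \<and> r mod 12 \<in> {5, 11}"
      by (simp add: lessThan_nat_numeral strip23_def odd_quot12_def)
    moreover have "min a 4 \<in> {..<5}" "min b 2 \<in> {..<3}" by auto
    ultimately show ?thesis using prime_mod_24[OF assms(1,2)] by blast
  qed
  also have "p mod 24 mod 12 = p mod 12"
    by (simp add: mod_mod_cancel)
  also have "min a 4 = 0 \<longleftrightarrow> a = 0" by auto
  also have "min a 4 = 1 \<longleftrightarrow> a = 1" by auto
  also have "min a 4 = 2 \<longleftrightarrow> a = 2" by auto
  also have "min b 2 = 0 \<longleftrightarrow> b = 0" by auto
  also have "min b 2 = 1 \<longleftrightarrow> b = 1" by auto
  finally show ?thesis .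
qed

theorem theorem5p2:
  fixes n :: nat
  assumes "n > 0"
  shows "odd (gen_totient 12 n) \<longleftrightarrow>
      (\<exists>\<alpha>::nat. \<alpha> \<ge> 4 \<and> n = 2 ^ \<alpha>) \<or>
      (\<exists>\<alpha>::nat. \<alpha> \<ge> 2 \<and> n = 3 * 2 ^ \<alpha>) \<or>
      (\<exists>\<beta>::nat. \<beta> \<ge> 2 \<and> n = 2 * 3 ^ \<beta>) \<or>
      (\<exists>\<beta>::nat. \<beta> \<ge> 2 \<and> n = 4 * 3 ^ \<beta>) \<or>
      (\<exists>(p::nat) (\<alpha>::nat). prime p \<and> p > 3 \<and> \<alpha> \<ge> 1 \<and>
        ((n = p ^ \<alpha> \<and> ([p = 13] (mod 24) \<or> [p = 17] (mod 24) \<or> [p = 19] (mod 24) \<or> [p = 23] (mod 24))) \<or>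
         (n = 2 * p ^ \<alpha> \<and> ([p = 7] (mod 24) \<or> [p = 11] (mod 24) \<or> [p = 13] (mod 24) \<or> [p = 17] (mod 24))) \<or>
         (n = 3 * p ^ \<alpha> \<and> ([p = 5] (mod 12) \<or> [p = 7] (mod 12))) \<or>
         (n = 4 * p ^ \<alpha> \<and> ([p = 5] (mod 12) \<or> [p = 7] (mod 12))) \<or>
         (n = 6 * p ^ \<alpha> \<and> ([p = 5] (mod 12) \<or> [p = 7] (mod 12))) \<or>
         (n = 12 * p ^ \<alpha> \<and> ([p = 5] (mod 12) \<or> [p = 11] (mod 12)))))"
  (is "_ \<longleftrightarrow> ?R")
proof
  assume odd: "odd (gen_totient 12 n)"
  obtain m where m: "n = 2 ^ multiplicity 2 n * m" "\<not> 2 dvd m"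
    using multiplicity_decompose'[of n 2] assms by auto
  have "m > 0" using m(2) by (cases m) auto
  then obtain k where k: "m = 3 ^ multiplicity 3 m * k" "\<not> 3 dvd k"
    using multiplicity_decompose'[of m 3] by auto
  have k2: "\<not> 2 dvd k" using m(2) k(1) by (metis dvd_mult)
  obtain a b where n: "n = 2 ^ a * 3 ^ b * k"
    using m(1) k(1) by (metis mult.assoc)
  show ?R
  proof (cases "k = 1")
    case True
    then show ?thesis
      using odd n odd_gen_totient_12_smooth[of a b] by (auto simp: mult.commute)
  next
    case False
    have "k > 1" using False k2 by (cases k) auto
    \<comment> \<open>Otherwise \<open>odd_count 12 y k\<close> fails for every \<open>y\<close>, so
      all four terms of \<open>strip23\<close> vanish, contradicting oddness.\<close>
    then have "\<exists>p \<alpha>. prime p \<and> \<alpha> > 0 \<and> k = p ^ \<alpha>"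
      using not_odd_count_12_of_not_prime_power[OF k2 k(2)] odd
      unfolding n odd_gen_totient_smooth_mult[OF k2 k(2)] strip23_def by blast
    then obtain p \<alpha> where p: "prime p" "\<alpha> > 0" "k = p ^ \<alpha>" by blast
    have "p dvd k" using p by simp
    then have p3: "p > 3"
      using k2 k(2) prime_gt_1_nat[OF p(1)] by (metis Suc_leI Suc_1 eval_nat_numeral(3) le_neq_implies_less)
    have "\<alpha> \<ge> 1" using p(2) by simp
    from odd have
      "n = p ^ \<alpha> \<and> p mod 24 \<in> {13, 17, 19, 23} \<or>
       n = 2 * p ^ \<alpha> \<and> p mod 24 \<in> {7, 11, 13, 17} \<or>
       n = 3 * p ^ \<alpha> \<and> p mod 12 \<in> {5, 7} \<or>
       n = 4 * p ^ \<alpha> \<and> p mod 12 \<in> {5, 7} \<or>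
       n = 6 * p ^ \<alpha> \<and> p mod 12 \<in> {5, 7} \<or>
       n = 12 * p ^ \<alpha> \<and> p mod 12 \<in> {5, 11}"
      unfolding n p(3) odd_gen_totient_12_prime_power[OF p(1) p3 p(2)]
      by (elim disjE conjE) simp_all
    then have "\<exists>p \<alpha>. prime p \<and> p > 3 \<and> \<alpha> \<ge> 1 \<and>
       (n = p ^ \<alpha> \<and> p mod 24 \<in> {13, 17, 19, 23} \<or>
       n = 2 * p ^ \<alpha> \<and> p mod 24 \<in> {7, 11, 13, 17} \<or>
       n = 3 * p ^ \<alpha> \<and> p mod 12 \<in> {5, 7} \<or>
       n = 4 * p ^ \<alpha> \<and> p mod 12 \<in> {5, 7} \<or>
       n = 6 * p ^ \<alpha> \<and> p mod 12 \<in> {5, 7} \<or>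
       n = 12 * p ^ \<alpha> \<and> p mod 12 \<in> {5, 11})"
      using p(1) p3 \<open>\<alpha> \<ge> 1\<close> by blast
    then show ?thesis by (simp add: cong_def)
  qed
next
  assume ?R
  \<comment> \<open>The four families without \<open>p\<close> merge into one case on the exponents
    of 2 and 3.\<close>
  then consider
      (smooth) a b where "n = 2 ^ a * 3 ^ b"
        "b = 0 \<and> a \<ge> 4 \<or> b = 1 \<and> a \<ge> 2 \<or> b \<ge> 2 \<and> (a = 1 \<or> a = 2)"
    | (prime) p \<alpha> where "prime p" "p > 3" "\<alpha> \<ge> 1"
        "n = p ^ \<alpha> \<and> p mod 24 \<in> {13, 17, 19, 23} \<or>
         n = 2 * p ^ \<alpha> \<and> p mod 24 \<in> {7, 11, 13, 17} \<or>
         n = 3 * p ^ \<alpha> \<and> p mod 12 \<in> {5, 7} \<or>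
         n = 4 * p ^ \<alpha> \<and> p mod 12 \<in> {5, 7} \<or>
         n = 6 * p ^ \<alpha> \<and> p mod 12 \<in> {5, 7} \<or>
         n = 12 * p ^ \<alpha> \<and> p mod 12 \<in> {5, 11}"
  proof (elim disjE exE conjE, goal_cases)
    case (1 \<alpha>) then show ?case by (intro smooth[of \<alpha> 0]) auto
  next
    case (2 \<alpha>) then show ?case by (intro smooth[of \<alpha> 1]) auto
  next
    case (3 \<beta>) then show ?case by (intro smooth[of 1 \<beta>]) auto
  next
    case (4 \<beta>) then show ?case by (intro smooth[of 2 \<beta>]) auto
  qed (rule prime, assumption+, simp add: cong_def)+
  then show "odd (gen_totient 12 n)"
  proof cases
    case smooth
    then show ?thesis using odd_gen_totient_12_smooth by blast
  next
    case prime
    then have "\<alpha> > 0" by simp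
    note odd_iff = odd_gen_totient_12_prime_power[OF prime(1,2) this]
    show ?thesis
      \<comment> \<open>The exponent pairs encode the multipliers 1, 2, 3, 4, 6 and 12.\<close>
      using prime(4) odd_iff[of 0 0] odd_iff[of 1 0] odd_iff[of 0 1] odd_iff[of 2 0]
        odd_iff[of 1 1] odd_iff[of 2 1]
      by auto
  qed
qed

end
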